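(* For every integer $k \ge 0$, \[ \sum_{p \in \mathbb{Z}} \sum_{q \in \mathbb{Z}} \binom{2k}{k+p} \binom{2k}{k+q}\, |p^2-q^2| = 2k^2{\binom{2k}{k}}^2 . \]
   Context: For integers $n \ge 0$ and $m$, the binomial coefficient $\binom{n}{m}$ is defined to be zero if $m < 0$ or $m > n$. With this convention, the sums over all integers $p$ and $q$ (positive, negative and zero) have only finitely many nonzero terms, namely those with $-k \le p \le k$ and $-k \le q \le k$. *)

theory Defs
  imports Main "HOL-Library.Groups_Big_Fun"
begin

definition int_binomial :: "nat \<Rightarrow> int \<Rightarrow> int" where
  "int_binomial n m = (if m < 0 \<or> m > int n then 0 else int (n choose nat m))"

lemma int_binomial_central_eq_0:
  "p \<notin> {- int k..int k} \<Longrightarrow> int_binomial (2 * k) (int k + p) = 0"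
  by (auto simp: int_binomial_def)

text \<open>
  \<^const>\<open>Sum_any\<close> is \<open>0\<close> by convention on functions of infinite support. The next two lemmas
  show that this convention never applies to the sums over all integers considered here.
\<close>

lemma finite_support_inner:
  "finite {q. int_binomial (2 * k) (int k + p) * int_binomial (2 * k) (int k + q)
                * \<bar>p\<^sup>2 - q\<^sup>2\<bar> \<noteq> 0}"
  by (rule finite_subset[of _ "{- int k..int k}"])
    (use int_binomial_central_eq_0 in fastforce)+

lemma finite_support_outer:
  "finite {p. Sum_any (\<lambda>q. int_binomial (2 * k) (int k + p) * int_binomial (2 * k) (int k + q)
                * \<bar>p\<^sup>2 - q\<^sup>2\<bar>) \<noteq> 0}"
proof (rule finite_subset[of _ "{- int k..int k}"])
  show "{p. Sum_any (\<lambda>q. int_binomial (2 * k) (int k + p) * int_binomial (2 * k) (int k + q)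
                * \<bar>p\<^sup>2 - q\<^sup>2\<bar>) \<noteq> 0} \<subseteq> {- int k..int k}"
  proof (rule subsetI, rule ccontr)
    fix p
    assume "p \<in> {p. Sum_any (\<lambda>q. int_binomial (2 * k) (int k + p)
                * int_binomial (2 * k) (int k + q) * \<bar>p\<^sup>2 - q\<^sup>2\<bar>) \<noteq> 0}"
      and "p \<notin> {- int k..int k}"
    then show False
      by (simp add: int_binomial_central_eq_0 del: atLeastAtMost_iff)
  qed
qed simp

end

theory Submission
  imports Defs
begin

text \<open>
  Put \<open>a\<^sub>p = C(2k, k + p)\<close> and \<open>A\<^sub>p = C(2k - 2, k - 1 + p)\<close>. Absorption gives
  \<open>(k\<^sup>2 - p\<^sup>2) a\<^sub>p = 2k(2k - 1) A\<^sub>p\<close>, so that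
  \<open>(p\<^sup>2 - q\<^sup>2) a\<^sub>p a\<^sub>q = 2k(2k - 1) (a\<^sub>p A\<^sub>q - A\<^sub>p a\<^sub>q)\<close>; since
  \<open>a\<^sub>p = A\<^bsub>p-1\<^esub> + 2A\<^sub>p + A\<^bsub>p+1\<^esub>\<close>, the bracket is a discrete wave operator applied to
  \<open>A\<^sub>p A\<^sub>q\<close>. By symmetry the sum is four times the sum over the cone \<open>\<bar>q\<bar> < p\<close>, on which the
  wave operator telescopes, leaving only the contribution \<open>A\<^sub>0 (A\<^sub>0 + A\<^sub>1) = A\<^sub>0 a\<^sub>0 / 2\<close> of
  the apex.
\<close>

lemma int_binomial_of_nat: "int_binomial n (int j) = int (n choose j)"
  by (simp add: int_binomial_def binomial_eq_0)

text \<open>Since entries outside the row are zero, Pascal's rule needs no side condition on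
  \<open>m\<close>; this lets later identities hold at every integer, including at the ends of a
  row.\<close>

lemma int_binomial_Suc:
  "int_binomial (Suc n) m = int_binomial n m + int_binomial n (m - 1)"
proof (cases "m \<le> 0")
  case True
  then show ?thesis
    by (cases "m = 0") (simp_all add: int_binomial_def)
next
  case False
  then obtain j where "m = int (Suc j)"
    by (metis gr0_implies_Suc not_le zero_less_imp_eq_int)
  then show ?thesis
    using int_binomial_of_nat[of _ "Suc j"] by (simp add: int_binomial_of_nat)
qed

lemma int_binomial_absorb:
  "m * int_binomial (Suc n) m = int (Suc n) * int_binomial n (m - 1)"
proof (cases "m \<le> 0")
  case True
  then show ?thesis
    by (cases "m = 0") (simp_all add: int_binomial_def)
next
  case False
  then obtain j where j: "m = int (Suc j)"
    by (metis gr0_implies_Suc not_le zero_less_imp_eq_int)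
  have "int (Suc j) * int (Suc n choose Suc j) = int (Suc n) * int (n choose j)"
    unfolding of_nat_mult[symmetric] by (simp only: Suc_times_binomial)
  moreover have "m - 1 = int j"
    using j by simp
  ultimately show ?thesis
    unfolding j by (simp only: int_binomial_of_nat)
qed

text \<open>Multiply Pascal's rule by \<open>Suc n\<close> and subtract the absorption
  identity.\<close>

lemma int_binomial_absorb_comp:
  "(int (Suc n) - m) * int_binomial (Suc n) m = int (Suc n) * int_binomial n m"
  using int_binomial_absorb[of m n] int_binomial_Suc[of n m] by (simp add: algebra_simps)

lemma int_binomial_symmetric: "int_binomial n (int n - m) = int_binomial n m"
proof -
  have "n choose nat (int n - m) = n choose nat m" if "0 \<le> m" "m \<le> int n"
    using binomial_symmetric[of "nat m" n] that by (simp add: nat_diff_distrib)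
  then show ?thesis
    by (auto simp: int_binomial_def)
qed

abbreviation central :: "nat \<Rightarrow> int \<Rightarrow> int" where
  "central k p \<equiv> int_binomial (2 * k) (int k + p)"

lemma central_minus: "central k (- p) = central k p"
  using int_binomial_symmetric[of "2 * k" "int k + p"] by simp

lemma central_Suc:
  "central (Suc n) p = central n (p - 1) + 2 * central n p + central n (p + 1)"
proof -
  have "int (Suc n) + p = (int n + p) + 1"
    by simp
  then show ?thesis
    using int_binomial_Suc[of "Suc (2 * n)" "int n + p + 1"]
      int_binomial_Suc[of "2 * n" "int n + p + 1"] int_binomial_Suc[of "2 * n" "int n + p"]
    by (simp add: algebra_simps)
qed

text \<open>The two factors of the difference of squares are absorbed in turn, descending from row
  \<open>2n + 2\<close> through the value \<open>b\<close> in row \<open>2n + 1\<close> to row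
  \<open>2n\<close>.\<close>

lemma central_absorb:
  "((int (Suc n))\<^sup>2 - p\<^sup>2) * central (Suc n) p
     = int (2 * n + 2) * int (2 * n + 1) * central n p"
proof -
  define b where "b = int_binomial (Suc (2 * n)) (int n + p)"
  have 1: "(int n + 1 + p) * central (Suc n) p = (2 * int n + 2) * b"
    using int_binomial_absorb[of "int n + 1 + p" "Suc (2 * n)"]
    by (simp add: b_def algebra_simps)
  have 2: "(int n + 1 - p) * b = (2 * int n + 1) * central n p"
    using int_binomial_absorb_comp[of "2 * n" "int n + p"]
    by (simp add: b_def algebra_simps)
  have "((int (Suc n))\<^sup>2 - p\<^sup>2) * central (Suc n) p
          = (int n + 1 - p) * ((int n + 1 + p) * central (Suc n) p)"
    by (simp add: power2_eq_square algebra_simps)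
  also have "\<dots> = (2 * int n + 2) * ((int n + 1 - p) * b)"
    by (simp only: 1 mult.left_commute)
  also have "\<dots> = int (2 * n + 2) * int (2 * n + 1) * central n p"
    by (simp only: 2) (simp add: algebra_simps)
  finally show ?thesis .
qed

lemma symmetric_interval_Suc:
  "{- int (Suc j)<..<int (Suc j)} = (if j = 0 then {0} else
     insert (int j) (insert (- int j) {- int j<..<int j}))"
  by auto

lemma sum_symmetric_interval_Suc:
  fixes f :: "int \<Rightarrow> int"
  assumes "j > 0"
  shows "(\<Sum>q\<in>{- int (Suc j)<..<int (Suc j)}. f q)
           = f (int j) + f (- int j) + (\<Sum>q\<in>{- int j<..<int j}. f q)"
  unfolding symmetric_interval_Suc using assms by simp

text \<open>Partial sums over the truncated cone depend only on the front \<open>j = m\<close> and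
  on the apex; the front terms are kept explicit so that induction on \<open>m\<close> goes
  through.\<close>

lemma sum_wave_operator:
  fixes A :: "int \<Rightarrow> int"
  assumes even: "\<And>q. A (- q) = A q"
  defines "G \<equiv> \<lambda>j. \<Sum>q\<in>{- int j<..<int j}. A q"
  shows "(\<Sum>j=1..m. \<Sum>q\<in>{- int j<..<int j}.
            (A (int j - 1) + A (int j + 1)) * A q - A (int j) * (A (q - 1) + A (q + 1)))
         = (A (int m + 1) - A (int m)) * G (Suc m) - 2 * A (int m) * A (int m + 1)
           + A 0 * (A 0 + A 1)"
proof (induction m)
  case 0
  have "{- 1<..<1::int} = {0}"
    by auto
  then show ?case
    by (simp add: G_def algebra_simps)
next
  case (Suc m)
  \<comment> \<open>Each of the two unit shifts of the interval gains the end value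
    \<open>A (j + 1)\<close> and loses \<open>A j\<close>, up to evenness.\<close>
  have neigh: "(\<Sum>q\<in>{- int (Suc j)<..<int (Suc j)}. A (q - 1) + A (q + 1))
      = 2 * G (Suc j) + 2 * A (int (Suc j)) - 2 * A (int j)" for j
  proof (induction j)
    case 0
    have "{- 1<..<1::int} = {0}"
      by auto
    then show ?case
      using even[of 1] by (simp add: G_def)
  next
    case (Suc j)
    show ?case
      using Suc even[of "int j"] even[of "int (Suc j)"] even[of "int (Suc (Suc j))"]
      unfolding G_def sum_symmetric_interval_Suc[OF zero_less_Suc]
      by (simp add: algebra_simps)
  qed
  have G: "G (Suc (Suc m)) = G (Suc m) + 2 * A (int (Suc m))"
    using even[of "int (Suc m)"]
    unfolding G_def sum_symmetric_interval_Suc[OF zero_less_Suc] by simp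
  have "(\<Sum>q\<in>{- int (Suc m)<..<int (Suc m)}.
          (A (int (Suc m) - 1) + A (int (Suc m) + 1)) * A q
            - A (int (Suc m)) * (A (q - 1) + A (q + 1)))
      = (A (int (Suc m) - 1) + A (int (Suc m) + 1)) * G (Suc m)
        - A (int (Suc m)) * (2 * G (Suc m) + 2 * A (int (Suc m)) - 2 * A (int m))"
    unfolding sum_subtractf sum_distrib_left[symmetric] neigh G_def by simp
  then show ?case
    using Suc G by (simp add: algebra_simps)
qed

lemma sum_even_interval:
  fixes f :: "int \<Rightarrow> int"
  assumes "\<And>p. f (- p) = f p"
  shows "(\<Sum>p\<in>{- int k..int k}. f p) = f 0 + 2 * (\<Sum>j=1..k. f (int j))"
proof (induction k)
  case (Suc k)
  have "{- int (Suc k)..int (Suc k)}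
          = insert (int (Suc k)) (insert (- int (Suc k)) {- int k..int k})"
    by auto
  then have "(\<Sum>p\<in>{- int (Suc k)..int (Suc k)}. f p)
      = f (int (Suc k)) + f (- int (Suc k)) + (\<Sum>p\<in>{- int k..int k}. f p)"
    by simp
  then show ?case
    using Suc assms[of "int (Suc k)"] by simp
qed simp

text \<open>One factor 2 comes from exchanging \<open>p\<close> and \<open>q\<close>, the other from
  the reflection of \<open>p\<close>; the diagonals where \<open>p\<close> and \<open>q\<close>
  agree up to sign contribute zero.\<close>

lemma sum_abs_diff_squares:
  fixes a :: "int \<Rightarrow> int"
  assumes even: "\<And>p. a (- p) = a p"
  shows "(\<Sum>p\<in>{- int k..int k}. \<Sum>q\<in>{- int k..int k}. a p * a q * \<bar>p\<^sup>2 - q\<^sup>2\<bar>)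
         = 4 * (\<Sum>j=1..k. \<Sum>q\<in>{- int j<..<int j}. ((int j)\<^sup>2 - q\<^sup>2) * (a (int j) * a q))"
proof -
  let ?P = "{- int k..int k}"
  define h where "h p q = (if \<bar>q\<bar> < \<bar>p\<bar> then (p\<^sup>2 - q\<^sup>2) * (a p * a q) else 0)" for p q
  define g where "g p = (\<Sum>q\<in>{- \<bar>p\<bar><..<\<bar>p\<bar>}. (p\<^sup>2 - q\<^sup>2) * (a p * a q))" for p
  have split: "a p * a q * \<bar>p\<^sup>2 - q\<^sup>2\<bar> = h p q + h q p" for p q
  proof -
    have "\<bar>q\<bar> < \<bar>p\<bar> \<longleftrightarrow> q\<^sup>2 < p\<^sup>2" "\<bar>p\<bar> < \<bar>q\<bar> \<longleftrightarrow> p\<^sup>2 < q\<^sup>2"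
      using abs_le_square_iff[of p q] abs_le_square_iff[of q p] by linarith+
    then show ?thesis
      unfolding h_def by (simp add: abs_if algebra_simps)
  qed
  have inner: "(\<Sum>q\<in>?P. h p q) = g p" if "p \<in> ?P" for p
  proof -
    have "?P \<inter> {q. \<bar>q\<bar> < \<bar>p\<bar>} = {- \<bar>p\<bar><..<\<bar>p\<bar>}"
      using that by auto
    then show ?thesis
      unfolding h_def g_def by (simp flip: sum.inter_restrict add: sum.If_cases)
  qed
  have "(\<Sum>p\<in>?P. \<Sum>q\<in>?P. a p * a q * \<bar>p\<^sup>2 - q\<^sup>2\<bar>)
      = (\<Sum>p\<in>?P. \<Sum>q\<in>?P. h p q) + (\<Sum>p\<in>?P. \<Sum>q\<in>?P. h q p)"
    by (simp only: split sum.distrib)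
  also have "(\<Sum>p\<in>?P. \<Sum>q\<in>?P. h q p) = (\<Sum>p\<in>?P. \<Sum>q\<in>?P. h p q)"
    by (rule sum.swap)
  also have "(\<Sum>p\<in>?P. \<Sum>q\<in>?P. h p q) = (\<Sum>p\<in>?P. g p)"
    by (intro sum.cong inner refl)
  also have "\<dots> = g 0 + 2 * (\<Sum>j=1..k. g (int j))"
    by (rule sum_even_interval) (simp add: g_def even)
  \<comment> \<open>The term \<open>g 0\<close> vanishes because its range of summation is
    empty.\<close>
  finally show ?thesis
    by (simp add: g_def)
qed

lemma Sum_any_central:
  "Sum_any (\<lambda>p. Sum_any (\<lambda>q. central k p * central k q * \<bar>p\<^sup>2 - q\<^sup>2\<bar>))
     = (\<Sum>p\<in>{- int k..int k}. \<Sum>q\<in>{- int k..int k}. central k p * central k q * \<bar>p\<^sup>2 - q\<^sup>2\<bar>)"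
proof -
  let ?P = "{- int k..int k}"
  have "Sum_any (\<lambda>q. central k p * central k q * \<bar>p\<^sup>2 - q\<^sup>2\<bar>)
      = (\<Sum>q\<in>?P. central k p * central k q * \<bar>p\<^sup>2 - q\<^sup>2\<bar>)" for p
    by (rule Sum_any.expand_superset) (use int_binomial_central_eq_0 in fastforce)+
  then show ?thesis
    by (simp only:)
      (rule Sum_any.expand_superset, simp,
        use int_binomial_central_eq_0 in \<open>fastforce intro: sum.neutral\<close>)
qed

theorem theorem1:
  fixes k :: nat
  shows "Sum_any (\<lambda>p :: int. Sum_any (\<lambda>q :: int.
           int_binomial (2 * k) (int k + p) * int_binomial (2 * k) (int k + q) * \<bar>p\<^sup>2 - q\<^sup>2\<bar>))
         = 2 * (int k)\<^sup>2 * (int ((2 * k) choose k))\<^sup>2"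
proof (cases k)
  \<comment> \<open>Row \<open>2k - 2\<close> makes sense only for positive \<open>k\<close>, so
    this case is checked directly.\<close>
  case 0
  then show ?thesis
    unfolding Sum_any_central by simp
next
  case (Suc n)
  define a where "a = central k"
  define A where "A = central n"
  define c where "c = int (2 * n + 2) * int (2 * n + 1)"
  have central_eq: "central k p = a p" for p
    by (simp only: a_def)
  have a_even: "a (- p) = a p" and A_even: "A (- p) = A p" for p
    by (simp_all only: a_def A_def central_minus)
  have a_rec: "a p = A (p - 1) + 2 * A p + A (p + 1)" for p
    unfolding a_def A_def Suc by (rule central_Suc)
  have absorb: "((int k)\<^sup>2 - p\<^sup>2) * a p = c * A p" for p
    unfolding a_def A_def c_def Suc by (rule central_absorb)
  have wave: "(p\<^sup>2 - q\<^sup>2) * (a p * a q)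
      = c * ((A (p - 1) + A (p + 1)) * A q - A p * (A (q - 1) + A (q + 1)))" for p q
  proof -
    \<comment> \<open>Inserting \<open>k\<close> squared splits the difference into two absorbable
      factors.\<close>
    have "(p\<^sup>2 - q\<^sup>2) * (a p * a q)
        = a p * (((int k)\<^sup>2 - q\<^sup>2) * a q) - a q * (((int k)\<^sup>2 - p\<^sup>2) * a p)"
      by (simp add: algebra_simps)
    also have "\<dots> = c * (a p * A q - A p * a q)"
      unfolding absorb by (simp add: algebra_simps)
    also have "a p * A q - A p * a q
        = (A (p - 1) + A (p + 1)) * A q - A p * (A (q - 1) + A (q + 1))"
      unfolding a_rec by (simp add: algebra_simps)
    finally show ?thesis .
  qed
  \<comment> \<open>\<open>A\<close> is supported on \<open>{- int n..int n}\<close> with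
    \<open>n = k - 1\<close>, so the front terms at \<open>j = k\<close> disappear.\<close>
  have "A (int k) = 0" "A (int k + 1) = 0"
    unfolding A_def Suc by (simp_all add: int_binomial_def)
  then have tele: "(\<Sum>j=1..k. \<Sum>q\<in>{- int j<..<int j}.
      (A (int j - 1) + A (int j + 1)) * A q - A (int j) * (A (q - 1) + A (q + 1)))
        = A 0 * (A 0 + A 1)"
    using sum_wave_operator[of A k, OF A_even] by simp
  have "a 0 = 2 * (A 0 + A 1)"
    using a_rec[of 0] A_even[of 1] by simp
  \<comment> \<open>Absorption at the centre removes the constant \<open>c\<close> and leaves only
    \<open>a 0\<close> in the apex term.\<close>
  moreover have "c * A 0 = (int k)\<^sup>2 * a 0"
    using absorb[of 0] by simp
  ultimately have "4 * (c * (A 0 * (A 0 + A 1))) = 2 * (int k)\<^sup>2 * (a 0)\<^sup>2"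
    by algebra
  moreover have "a 0 = int ((2 * k) choose k)"
    unfolding a_def by (simp add: int_binomial_of_nat)
  ultimately show ?thesis
    unfolding Sum_any_central
    unfolding central_eq sum_abs_diff_squares[of a, OF a_even]
      wave sum_distrib_left[symmetric] tele
    by simp
qed

end
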